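(* Fix integers $1\leq k\leq n$ and write $n=ka+b$ with integers $a\geq 0$ and $0\leq b\leq k-1$. Then \[|\mathrm{VPF}_n(k)| \;=\; \left(\frac{n!}{\prod_{t=0}^{k-1}\left\lfloor\frac{n+t}{k}\right\rfloor!}\right)\cdot|\mathrm{VPF}_{a+1}|^b\cdot|\mathrm{VPF}_{a}|^{k-b},\] where $|\mathrm{VPF}_{0}|\coloneqq 1$.
   Context: For $n\in\mathbb{N}$ let $[n]=\{1,\dots,n\}$. Fix $k\in[n]$. A preference list $\alpha=(a_1,\dots,a_n)\in[n]^n$ describes $n$ cars entering, in order $i=1,2,\dots,n$, a one-way street with parking spots numbered $1,\dots,n$; car $i$ prefers spot $a_i$. Under the $k$-vacillating parking rule, car $i$ parks in spot $a_i$ if it is unoccupied; otherwise it checks spot $a_i-k$ and parks there if that spot exists and is unoccupied; otherwise it checks spot $a_i+k$ and parks there if that spot exists and is unoccupied; otherwise car $i$ fails to park. If all $n$ cars park, $\alpha$ is a $k$-vacillating parking function of length $n$. $\mathrm{VPF}_n(k)$ denotes the set of these, and $\mathrm{VPF}_n\coloneqq\mathrm{VPF}_n(1)$ (the vacillating parking functions of length $n$). *)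

theory Defs
  imports Complex_Main
begin

(* Spots are numbered 1, ..., n and occ is the set of occupied spots. The guard k < a expresses that
   spot a - k exists (is at least 1); subtraction on nat would truncate otherwise. None: the car
   fails to park. *)
definition vacillating_spot :: "nat \<Rightarrow> nat \<Rightarrow> nat set \<Rightarrow> nat \<Rightarrow> nat option" where
  "vacillating_spot n k occ a =
    (if a \<notin> occ then Some a
     else if k < a \<and> a - k \<notin> occ then Some (a - k)
     else if a + k \<le> n \<and> a + k \<notin> occ then Some (a + k)
     else None)"

primrec all_park :: "nat \<Rightarrow> nat \<Rightarrow> nat set \<Rightarrow> nat list \<Rightarrow> bool" where
  "all_park n k occ [] \<longleftrightarrow> True"
| "all_park n k occ (a # as) \<longleftrightarrow>
    (case vacillating_spot n k occ a of
       None \<Rightarrow> False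
     | Some s \<Rightarrow> all_park n k (insert s occ) as)"

definition preference_lists :: "nat \<Rightarrow> nat list set" where
  "preference_lists n = {\<alpha>. length \<alpha> = n \<and> set \<alpha> \<subseteq> {1..n}}"

definition VPF :: "nat \<Rightarrow> nat \<Rightarrow> nat list set" where
  "VPF n k = {\<alpha> \<in> preference_lists n. all_park n k {} \<alpha>}"

lemma finite_VPF: "finite (VPF n k)"
proof (rule finite_subset)
  show "VPF n k \<subseteq> {\<alpha>. set \<alpha> \<subseteq> {1..n} \<and> length \<alpha> = n}"
    by (auto simp: VPF_def preference_lists_def)
  show "finite {\<alpha>. set \<alpha> \<subseteq> {1..n} \<and> length \<alpha> = n}"
    by (rule finite_lists_length_eq) simp
qed

(* The convention that there is exactly one vacillating parking function of length 0 holds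
   by definition. *)
lemma card_VPF_0: "card (VPF 0 k) = 1"
proof -
  have "VPF 0 k = {[]}"
    by (auto simp: VPF_def preference_lists_def)
  then show ?thesis by simp
qed

end

(* A car never leaves the residue class modulo k of its preferred spot, and inside one class the
   k-vacillating rule is the 1-vacillating rule on the renumbered spots of that class. So a list is
   a k-vacillating parking function iff its subsequence in every class, renumbered, is a vacillating
   parking function of the size of that class. Such lists are the interleavings of k independently
   chosen lists over disjoint alphabets, and these are counted by a multinomial coefficient. The
   lengths of the subsequences are forced: no class can hold more cars than it has spots, and the
   sizes sum to n. *)
theory Submission
  imports Defs
begin

section \<open>Counting interleavings of lists over disjoint alphabets\<close>

text \<open>The lists with filters \<open>ys\<close> and \<open>zs\<close> are exactly the shuffles
  of \<open>ys\<close> and \<open>zs\<close>. As these two share no entry, their shuffles number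
  \<open>(m1 + m2) choose m1\<close>, the same for every pair.\<close>

lemma card_partitioned_lists:
  assumes fin: "finite L1" "finite L2"
    and L1: "\<And>ys. ys \<in> L1 \<Longrightarrow> length ys = m1 \<and> (\<forall>y\<in>set ys. P y)"
    and L2: "\<And>zs. zs \<in> L2 \<Longrightarrow> length zs = m2 \<and> (\<forall>z\<in>set zs. \<not> P z)"
  shows "finite {xs. filter P xs \<in> L1 \<and> filter (\<lambda>x. \<not> P x) xs \<in> L2}" (is "finite ?S")
    and "card {xs. filter P xs \<in> L1 \<and> filter (\<lambda>x. \<not> P x) xs \<in> L2} =
      ((m1 + m2) choose m1) * (card L1 * card L2)"
proof -
  let ?T = "\<lambda>(ys, zs). shuffles ys zs"
  have disj: "set ys \<inter> set zs = {}" if "ys \<in> L1" "zs \<in> L2" for ys zs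
    using L1[OF that(1)] L2[OF that(2)] by blast
  have filt: "filter P xs = ys \<and> filter (\<lambda>x. \<not> P x) xs = zs"
    if "ys \<in> L1" "zs \<in> L2" "xs \<in> shuffles ys zs" for xs ys zs
  proof -
    have "filter P xs \<in> shuffles (filter P ys) (filter P zs)"
      "filter (\<lambda>x. \<not> P x) xs \<in> shuffles (filter (\<lambda>x. \<not> P x) ys) (filter (\<lambda>x. \<not> P x) zs)"
      using that(3) by (simp_all flip: filter_shuffles)
    moreover have "filter P ys = ys" "filter P zs = []"
      "filter (\<lambda>x. \<not> P x) ys = []" "filter (\<lambda>x. \<not> P x) zs = zs"
      using L1[OF that(1)] L2[OF that(2)] by (simp_all add: filter_id_conv filter_empty_conv)
    ultimately show ?thesis by simp
  qed
  have S: "?S = (\<Union>p\<in>L1 \<times> L2. ?T p)"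
  proof (intro equalityI subsetI)
    fix xs assume "xs \<in> ?S"
    then show "xs \<in> (\<Union>p\<in>L1 \<times> L2. ?T p)"
      using partition_in_shuffles[of xs P]
      by (intro UN_I[of "(filter P xs, filter (\<lambda>x. \<not> P x) xs)"]) auto
  next
    fix xs assume "xs \<in> (\<Union>p\<in>L1 \<times> L2. ?T p)"
    then obtain ys zs where "ys \<in> L1" "zs \<in> L2" "xs \<in> shuffles ys zs" by auto
    then show "xs \<in> ?S" using filt by auto
  qed
  show "finite ?S"
    unfolding S using fin by auto
  have "card ?S = (\<Sum>p\<in>L1 \<times> L2. card (?T p))"
    unfolding S
  proof (rule card_UN_disjoint)
    \<comment> \<open>By \<open>filt\<close>, a common shuffle would determine both pairs as its two
      filters.\<close>
    show "\<forall>p\<in>L1 \<times> L2. \<forall>q\<in>L1 \<times> L2. p \<noteq> q \<longrightarrow> ?T p \<inter> ?T q = {}"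
      using filt by (auto; metis)
  qed (use fin in auto)
  also have "\<dots> = (\<Sum>p\<in>L1 \<times> L2. (m1 + m2) choose m1)"
    using L1 L2 disj by (intro sum.cong) (auto simp: card_disjoint_shuffles)
  finally show "card ?S = ((m1 + m2) choose m1) * (card L1 * card L2)"
    by (simp add: card_cartesian_product)
qed

text \<open>Induction on \<open>R\<close>: a new class \<open>r\<close> is one alphabet, the union
  of the earlier classes the other, and the binomial coefficients multiply up to a multinomial one.
  Finiteness and the common length are carried along since the two-alphabet count requires them.
  Keeping the factorials on the left avoids division on \<open>nat\<close>.\<close>

lemma card_interleavings:
  assumes "finite R"
    and "\<And>r. r \<in> R \<Longrightarrow> finite (L r)"
    and "\<And>r ys. r \<in> R \<Longrightarrow> ys \<in> L r \<Longrightarrow> length ys = m r \<and> (\<forall>y\<in>set ys. c y = r)"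
  defines "S \<equiv> \<lambda>R. {xs. c ` set xs \<subseteq> R \<and> (\<forall>r\<in>R. filter (\<lambda>x. c x = r) xs \<in> L r)}"
  shows "finite (S R) \<and> (\<forall>xs\<in>S R. length xs = (\<Sum>r\<in>R. m r)) \<and>
    (\<Prod>r\<in>R. fact (m r)) * card (S R) = fact (\<Sum>r\<in>R. m r) * (\<Prod>r\<in>R. card (L r))"
  using assms(1-3)
proof (induction R)
  case empty
  have "S {} = {[]}" by (auto simp: S_def)
  then show ?case by simp
next
  case (insert r R)
  have IH: "finite (S R)" "\<And>xs. xs \<in> S R \<Longrightarrow> length xs = (\<Sum>r\<in>R. m r)"
    "(\<Prod>r\<in>R. fact (m r)) * card (S R) = fact (\<Sum>r\<in>R. m r) * (\<Prod>r\<in>R. card (L r))"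
    using insert by auto
  have restrict: "filter (\<lambda>x. c x = r') (filter (\<lambda>x. c x \<noteq> r) xs) = filter (\<lambda>x. c x = r') xs"
    if "r' \<in> R" for r' xs
    using that insert.hyps by (auto intro!: filter_cong)
  have eq: "S (insert r R) =
      {xs. filter (\<lambda>x. c x = r) xs \<in> L r \<and> filter (\<lambda>x. c x \<noteq> r) xs \<in> S R}"
    unfolding S_def using insert.hyps by (auto simp: restrict simp del: filter_filter)
  have L1: "length ys = m r \<and> (\<forall>y\<in>set ys. c y = r)" if "ys \<in> L r" for ys
    using insert.prems that by blast
  have L2: "length zs = (\<Sum>r\<in>R. m r) \<and> (\<forall>z\<in>set zs. c z \<noteq> r)" if "zs \<in> S R" for zs
    using IH(2)[OF that] that insert.hyps by (auto simp: S_def)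
  note parts = card_partitioned_lists[of "L r" "S R" "m r" "\<lambda>x. c x = r", OF _ IH(1) L1 L2]
  let ?s = "\<Sum>r\<in>R. m r"
  have fin: "finite (S (insert r R))"
    unfolding eq using parts(1) insert.prems by simp
  have len: "length xs = m r + ?s" if "xs \<in> S (insert r R)" for xs
  proof -
    have "length (filter (\<lambda>x. c x = r) xs) = m r" "length (filter (\<lambda>x. c x \<noteq> r) xs) = ?s"
      using that L1 L2 unfolding eq by blast+
    then show ?thesis
      using sum_length_filter_compl[of "\<lambda>x. c x = r" xs] by simp
  qed
  have "card (S (insert r R)) = ((m r + ?s) choose m r) * (card (L r) * card (S R))"
    unfolding eq using parts(2) insert.prems by simp
  then have "(fact (m r) * (\<Prod>r\<in>R. fact (m r))) * card (S (insert r R)) =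
      fact (m r) * ((m r + ?s) choose m r) * card (L r) * ((\<Prod>r\<in>R. fact (m r)) * card (S R))"
    by (simp add: mult_ac)
  also have "\<dots> = (fact (m r) * fact ?s * ((m r + ?s) choose m r)) *
      (card (L r) * (\<Prod>r\<in>R. card (L r)))"
    unfolding IH(3) by (simp add: mult_ac)
  also have "fact (m r) * fact ?s * ((m r + ?s) choose m r) = fact (m r + ?s)"
    using binomial_fact_lemma[of "m r" "m r + ?s"] by simp
  finally show ?case
    using fin len insert.hyps by simp
qed

section \<open>Lengths of parked lists and of their class subsequences\<close>

lemma vacillating_spot_Some:
  assumes "vacillating_spot n k occ x = Some s" "x \<in> {1..n}"
  shows "s \<in> {1..n} - occ"
  using assms by (auto simp: vacillating_spot_def split: if_splits)

text \<open>Each parked car occupies a fresh spot in \<open>{1..n}\<close>. Applied inside one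
  class, this bounds the number of its cars by the number of its spots.\<close>

lemma all_park_length:
  assumes "all_park n k occ xs" "set xs \<subseteq> {1..n}" "occ \<subseteq> {1..n}"
  shows "card occ + length xs \<le> n"
  using assms
proof (induction xs arbitrary: occ)
  case Nil
  then show ?case using card_mono[of "{1..n}" occ] by simp
next
  case (Cons x xs)
  then obtain s where s: "vacillating_spot n k occ x = Some s" "all_park n k (insert s occ) xs"
    by (auto split: option.splits)
  have "s \<in> {1..n} - occ"
    using vacillating_spot_Some[OF s(1)] Cons.prems(2) by simp
  moreover have "finite occ"
    using Cons.prems(3) finite_subset by blast
  ultimately show ?case
    using Cons.IH[OF s(2)] Cons.prems by simp
qed

lemma sum_length_filter_classes:
  assumes "finite R" "c ` set xs \<subseteq> R"
  shows "(\<Sum>r\<in>R. length (filter (\<lambda>x. c x = r) xs)) = length xs"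
  using assms(2)
proof (induction xs)
  case (Cons x xs)
  have "(\<Sum>r\<in>R. length (filter (\<lambda>y. c y = r) (x # xs))) =
      (\<Sum>r\<in>R. (if c x = r then 1 else 0) + length (filter (\<lambda>y. c y = r) xs))"
    by (intro sum.cong) auto
  also have "\<dots> = 1 + length xs"
    using Cons assms(1) by (simp add: sum.distrib)
  finally show ?case by simp
qed simp

section \<open>Residue classes of spots and their renumbering\<close>

text \<open>Residues are numbered from 0 and spots from 1: the \<open>i\<close>-th spot of class \<open>r < k\<close> is
  \<open>k * (i - 1) + r + 1\<close>. Spot 0 and index 0 do not exist.\<close>

definition spot_class :: "nat \<Rightarrow> nat \<Rightarrow> nat" where
  "spot_class k x = (x - 1) mod k"

definition class_index :: "nat \<Rightarrow> nat \<Rightarrow> nat" where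
  "class_index k x = Suc ((x - 1) div k)"

definition class_spot :: "nat \<Rightarrow> nat \<Rightarrow> nat \<Rightarrow> nat" where
  "class_spot k r i = k * (i - 1) + r + 1"

text \<open>The condition \<open>1 \<le> i\<close> matters: by truncated subtraction
  \<open>class_spot k r 0\<close> equals \<open>class_spot k r 1\<close>, so index 0 would otherwise
  count as occupied together with index 1.\<close>

definition class_occ :: "nat \<Rightarrow> nat \<Rightarrow> nat set \<Rightarrow> nat set" where
  "class_occ k r occ = {i. 1 \<le> i \<and> class_spot k r i \<in> occ}"

lemma class_spot_inverse [simp]:
  assumes "r < k"
  shows "spot_class k (class_spot k r i) = r"
    and "1 \<le> i \<Longrightarrow> class_index k (class_spot k r i) = i"
  using assms by (auto simp: spot_class_def class_index_def class_spot_def)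

lemma class_spot_class_index:
  assumes "1 \<le> x"
  shows "class_spot k (spot_class k x) (class_index k x) = x"
  using assms by (simp add: spot_class_def class_index_def class_spot_def)

lemma class_spot_inj:
  assumes "r < k" "1 \<le> i" "1 \<le> j"
  shows "class_spot k r i = class_spot k r j \<longleftrightarrow> i = j"
  using class_spot_inverse(2)[OF assms(1)] assms by metis

text \<open>The first \<open>k * a\<close> spots contain \<open>a\<close> from every class; the last
  \<open>b\<close> spots add one to each of the classes below \<open>b\<close>.\<close>

lemma class_spot_le_iff:
  assumes "r < k" "b < k" "1 \<le> i"
  shows "class_spot k r i \<le> k * a + b \<longleftrightarrow> i \<le> (if r < b then a + 1 else a)"
proof -
  obtain j where i: "i = Suc j" using assms(3) by (cases i) auto
  consider "j < a" | "j = a" | "a < j" by linarith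
  then show ?thesis
  proof cases
    case 1
    then have "k * Suc j \<le> k * a" by (intro mult_le_mono) auto
    then show ?thesis using 1 assms by (auto simp: i class_spot_def)
  next
    case 2
    then show ?thesis using assms by (auto simp: i class_spot_def)
  next
    case 3
    then have "k * Suc a \<le> k * j" by (intro mult_le_mono) auto
    then show ?thesis using 3 assms by (auto simp: i class_spot_def)
  qed
qed

lemma class_occ_insert:
  assumes "r < k" "r' < k" "1 \<le> j"
  shows "class_occ k r' (insert (class_spot k r j) occ) =
    (if r' = r then insert j (class_occ k r occ) else class_occ k r' occ)"
proof (cases "r' = r")
  case True
  then show ?thesis using assms class_spot_inj by (auto simp: class_occ_def)
next
  case False
  then have "class_spot k r' i \<noteq> class_spot k r j" for i
    using assms class_spot_inverse(1) by metis
  then show ?thesis using False by (auto simp: class_occ_def)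
qed

section \<open>Reduction of the parking rule to the classes\<close>

text \<open>A step of \<open>k\<close> along the street is a step of 1 in the index. The tests for
  falling off either end agree as well: at the top by the assumption on \<open>m\<close>, at the
  bottom because \<open>k < class_spot k r i\<close> amounts to \<open>1 < i\<close>.\<close>

lemma vacillating_spot_class_spot:
  assumes "r < k" "1 \<le> i" and m: "\<And>j. 1 \<le> j \<Longrightarrow> class_spot k r j \<le> n \<longleftrightarrow> j \<le> m"
  shows "vacillating_spot n k occ (class_spot k r i) =
    map_option (class_spot k r) (vacillating_spot m 1 (class_occ k r occ) i)"
proof -
  obtain j where i: "i = Suc j" using assms(2) by (cases i) auto
  have up: "class_spot k r i + k = class_spot k r (i + 1)"
    by (simp add: i class_spot_def)
  have down: "k < class_spot k r i \<longleftrightarrow> 1 < i"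
    using assms(1) by (cases j) (auto simp: i class_spot_def)
  have down': "class_spot k r i - k = class_spot k r (i - 1)" if "1 < i"
    using that by (cases j) (auto simp: i class_spot_def)
  show ?thesis
    using assms(2) m[of "i + 1"] down'
    by (auto simp: vacillating_spot_def class_occ_def up down)
qed

text \<open>Induction on the cars with arbitrary occupancy: the first car is also the first of its
  own class and changes the occupancy there only, so every other class keeps both its list and its
  occupied spots.\<close>

lemma all_park_iff_classes:
  assumes m: "\<And>r i. r < k \<Longrightarrow> 1 \<le> i \<Longrightarrow> class_spot k r i \<le> n \<longleftrightarrow> i \<le> m r"
    and "0 < k" "set xs \<subseteq> {1..n}"
  shows "all_park n k occ xs \<longleftrightarrow>
    (\<forall>r<k. all_park (m r) 1 (class_occ k r occ)
      (map (class_index k) (filter (\<lambda>x. spot_class k x = r) xs)))"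
  using assms(3)
proof (induction xs arbitrary: occ)
  case (Cons x xs)
  define r where "r = spot_class k x"
  define i where "i = class_index k x"
  have r: "r < k" using assms(2) by (simp add: r_def spot_class_def)
  have i: "1 \<le> i" by (simp add: i_def class_index_def)
  have x: "x = class_spot k r i"
    using Cons.prems by (simp add: r_def i_def class_spot_class_index)
  have "i \<le> m r" using m[OF r i] Cons.prems by (simp add: x)
  have step: "vacillating_spot n k occ x =
      map_option (class_spot k r) (vacillating_spot (m r) 1 (class_occ k r occ) i)"
    unfolding x using vacillating_spot_class_spot[OF r i] m[OF r] by blast
  let ?sub = "\<lambda>r' xs. map (class_index k) (filter (\<lambda>x. spot_class k x = r') xs)"
  have sub: "?sub r' (x # xs) = (if r' = r then i # ?sub r xs else ?sub r' xs)" for r'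
    by (simp add: r_def i_def)
  show ?case
  proof (cases "vacillating_spot (m r) 1 (class_occ k r occ) i")
    case None
    then have "\<not> all_park (m r) 1 (class_occ k r occ) (?sub r (x # xs))"
      by (simp only: sub) simp
    moreover have "\<not> all_park n k occ (x # xs)"
      using step None by simp
    ultimately show ?thesis using r by blast
  next
    case (Some j)
    \<comment> \<open>The index taken is not 0; only then does occupying its spot add exactly
      \<open>j\<close> to the occupancy of class \<open>r\<close>.\<close>
    have "1 \<le> j" using vacillating_spot_Some[OF Some] i \<open>i \<le> m r\<close> by simp
    have "all_park n k occ (x # xs) \<longleftrightarrow> all_park n k (insert (class_spot k r j) occ) xs"
      using step Some by simp
    also have "\<dots> \<longleftrightarrow> (\<forall>r'<k. all_park (m r') 1
        (class_occ k r' (insert (class_spot k r j) occ)) (?sub r' xs))"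
      using Cons by simp
    also have "\<dots> \<longleftrightarrow> (\<forall>r'<k. all_park (m r') 1 (class_occ k r' occ) (?sub r' (x # xs)))"
    proof (intro all_cong)
      fix r' assume "r' < k"
      then show "all_park (m r') 1 (class_occ k r' (insert (class_spot k r j) occ)) (?sub r' xs) =
        all_park (m r') 1 (class_occ k r' occ) (?sub r' (x # xs))"
        using Some by (simp only: sub class_occ_insert[OF r _ \<open>1 \<le> j\<close>]) simp
    qed
    finally show ?thesis .
  qed
qed simp

text \<open>The right-hand side has the shape counted by \<open>card_interleavings\<close>. Parking
  transfers by \<open>all_park_iff_classes\<close>; the remaining work is to match lengths and
  ranges of entries.\<close>

lemma VPF_eq_interleavings:
  assumes m: "\<And>r i. r < k \<Longrightarrow> 1 \<le> i \<Longrightarrow> class_spot k r i \<le> n \<longleftrightarrow> i \<le> m r"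
    and "0 < k" and n: "(\<Sum>r<k. m r) = n"
  shows "VPF n k = {xs. spot_class k ` set xs \<subseteq> {..<k} \<and>
    (\<forall>r\<in>{..<k}. filter (\<lambda>x. spot_class k x = r) xs \<in> map (class_spot k r) ` VPF (m r) 1)}"
    (is "_ = ?S")
proof (intro equalityI subsetI)
  have cls: "spot_class k x < k" for x
    using assms(2) by (simp add: spot_class_def)
  have occ: "class_occ k r {} = {}" for r
    by (simp add: class_occ_def)
  let ?f = "\<lambda>r xs. filter (\<lambda>x. spot_class k x = r) xs"
  let ?sub = "\<lambda>r xs. map (class_index k) (?f r xs)"
  have total: "(\<Sum>r<k. length (?f r xs)) = length xs" for xs
    by (rule sum_length_filter_classes) (auto simp: cls)
  {
    fix xs assume "xs \<in> VPF n k"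
    then have xs: "length xs = n" "set xs \<subseteq> {1..n}" "all_park n k {} xs"
      by (auto simp: VPF_def preference_lists_def)
    have park: "all_park (m r) 1 {} (?sub r xs)" if "r < k" for r
      using all_park_iff_classes[of k n m, OF m assms(2) xs(2)] xs(3) that by (simp add: occ)
    have idx: "set (?sub r xs) \<subseteq> {1..m r}" if "r < k" for r
    proof clarsimp
      fix x assume "x \<in> set xs" "r = spot_class k x"
      then show "Suc 0 \<le> class_index k x \<and> class_index k x \<le> m (spot_class k x)"
        using m[OF cls, of "class_index k x" x] xs(2) class_spot_class_index[of x k]
        by (auto simp: class_index_def)
    qed
    have le: "length (?f r xs) \<le> m r" if "r < k" for r
      using all_park_length[OF park idx] that by simp
    \<comment> \<open>Equal sums together with the termwise bound \<open>le\<close> force equality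
      in every class.\<close>
    have "(\<Sum>r<k. length (?f r xs)) = (\<Sum>r<k. m r)"
      using total xs(1) n by simp
    then have len: "length (?f r xs) = m r" if "r < k" for r
      using sum_mono_inv[of "\<lambda>r. length (?f r xs)" "{..<k}" m r] le that by simp
    have "?f r xs \<in> map (class_spot k r) ` VPF (m r) 1" if "r < k" for r
    proof
      show "?f r xs = map (class_spot k r) (?sub r xs)"
        using xs(2) by (force simp: class_spot_class_index intro!: map_idI[symmetric])
      show "?sub r xs \<in> VPF (m r) 1"
        using park idx len that by (simp add: VPF_def preference_lists_def)
    qed
    then show "xs \<in> ?S" using cls by auto
  }
  {
    fix xs assume xs: "xs \<in> ?S"
    have "\<exists>ys \<in> VPF (m r) 1. ?f r xs = map (class_spot k r) ys" if "r < k" for r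
      using xs that by auto
    then obtain ys where ys: "\<And>r. r < k \<Longrightarrow> ys r \<in> VPF (m r) 1"
      "\<And>r. r < k \<Longrightarrow> ?f r xs = map (class_spot k r) (ys r)"
      by metis
    have ys': "length (ys r) = m r" "set (ys r) \<subseteq> {1..m r}" "all_park (m r) 1 {} (ys r)"
      if "r < k" for r
      using ys(1)[OF that] by (auto simp: VPF_def preference_lists_def)
    have sub: "?sub r xs = ys r" if "r < k" for r
      using ys(2)[OF that] ys'(2)[OF that] that by (force intro!: map_idI)
    \<comment> \<open>The right-hand set constrains entries only through their classes, so the range
      is recovered from the index of \<open>x\<close> within its class.\<close>
    have "x \<in> {1..n}" if "x \<in> set xs" for x
    proof -
      have "x \<in> set (?f (spot_class k x) xs)" using that by simp
      then obtain i where "i \<in> set (ys (spot_class k x))" "x = class_spot k (spot_class k x) i"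
        using ys(2)[OF cls] by auto
      then show ?thesis
        using m[OF cls, of i x] ys'(2)[OF cls, of x] by (auto simp: class_spot_def)
    qed
    then have "set xs \<subseteq> {1..n}" by blast
    moreover have "length xs = n"
    proof -
      have "length xs = (\<Sum>r<k. length (?f r xs))"
        by (simp only: total)
      also have "\<dots> = n" using n ys(2) ys'(1) by simp
      finally show ?thesis .
    qed
    moreover have "all_park n k {} xs"
      using all_park_iff_classes[of k n m, OF m assms(2) \<open>set xs \<subseteq> {1..n}\<close>] ys'(3) sub
      by (simp add: occ)
    ultimately show "xs \<in> VPF n k"
      by (simp add: VPF_def preference_lists_def)
  }
qed

section \<open>The product formula and its factorial denominator\<close>

lemma prod_if_less:
  fixes u v :: "'a :: comm_monoid_mult"
  assumes "b \<le> k"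
  shows "(\<Prod>r<k. if r < b then u else v) = u ^ b * v ^ (k - b)"
proof -
  have "{..<k} \<inter> {r. r < b} = {..<b}" "{..<k} \<inter> - {r. r < b} = {b..<k}"
    using assms by auto
  then show ?thesis by (simp add: prod.If_cases)
qed

theorem theorem4p1:
  fixes n k a b :: nat
  assumes "1 \<le> k" and "k \<le> n"
    and "n = k * a + b" and "b \<le> k - 1"
  shows "real (card (VPF n k)) =
    (fact n / (\<Prod>t = 0..k - 1. fact ((n + t) div k)))
      * real (card (VPF (a + 1) 1)) ^ b * real (card (VPF a 1)) ^ (k - b)"
proof -
  define m where "m r = (if r < b then a + 1 else a)" for r
  have b: "b < k" using assms by linarith
  have m: "class_spot k r i \<le> n \<longleftrightarrow> i \<le> m r" if "r < k" "1 \<le> i" for r i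
    using class_spot_le_iff[OF that(1) b that(2)] by (simp add: m_def assms(3))
  have n: "(\<Sum>r<k. m r) = n"
  proof -
    have "{..<k} \<inter> {r. r < b} = {..<b}" using b by auto
    moreover have "(\<Sum>r<k. m r) = (\<Sum>r<k. a + (if r < b then 1 else 0))"
      by (intro sum.cong) (auto simp: m_def)
    ultimately show ?thesis by (simp add: sum.distrib sum.If_cases assms(3))
  qed
  let ?L = "\<lambda>r. map (class_spot k r) ` VPF (m r) 1"
  have L: "length ys = m r \<and> (\<forall>y\<in>set ys. spot_class k y = r)"
    if "r \<in> {..<k}" "ys \<in> ?L r" for r ys
    using that by (auto simp: VPF_def preference_lists_def)
  have card_L: "card (?L r) = card (VPF (m r) 1)" if "r < k" for r
  proof (rule card_image)
    show "inj_on (map (class_spot k r)) (VPF (m r) 1)"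
    proof (rule inj_on_inverseI)
      fix ys assume "ys \<in> VPF (m r) 1"
      then show "map (class_index k) (map (class_spot k r) ys) = ys"
        using that by (auto simp: VPF_def preference_lists_def intro!: map_idI)
    qed
  qed
  have "(\<Prod>r<k. fact (m r)) * card (VPF n k) = fact n * (\<Prod>r<k. card (?L r))"
    using card_interleavings[of "{..<k}" ?L m "spot_class k", OF _ _ L]
      VPF_eq_interleavings[of k n m, OF m _ n] assms(1) n by (simp add: finite_VPF)
  also have "(\<Prod>r<k. card (?L r)) = (\<Prod>r<k. card (VPF (m r) 1))"
    by (intro prod.cong refl card_L) simp
  also have "\<dots> = (\<Prod>r<k. if r < b then card (VPF (a + 1) 1) else card (VPF a 1))"
    by (intro prod.cong) (simp_all add: m_def)
  also have "\<dots> = card (VPF (a + 1) 1) ^ b * card (VPF a 1) ^ (k - b)"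
    using b by (simp add: prod_if_less)
  finally have "real ((\<Prod>r<k. fact (m r)) * card (VPF n k)) =
      real (fact n * (card (VPF (a + 1) 1) ^ b * card (VPF a 1) ^ (k - b)))"
    by (simp only:)
  then have count: "(\<Prod>r<k. fact (m r)) * real (card (VPF n k)) =
      fact n * (real (card (VPF (a + 1) 1)) ^ b * real (card (VPF a 1)) ^ (k - b))"
    by simp
  have "(\<Prod>t = 0..k - 1. fact ((n + t) div k)) = (\<Prod>t<k. fact ((n + t) div k) :: real)"
    using assms(1) by (intro prod.cong) auto
  \<comment> \<open>The stated denominator lists the class sizes in reverse: the factor for
    \<open>t = k - 1 - r\<close> belongs to class \<open>r\<close>.\<close>
  also have "\<dots> = (\<Prod>r<k. fact ((n + (k - Suc r)) div k))"
    by (rule prod.nat_diff_reindex[symmetric])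
  also have "\<dots> = (\<Prod>r<k. fact (m r))"
  proof (intro prod.cong refl)
    fix r assume "r \<in> {..<k}"
    \<comment> \<open>The numerator is below \<open>2 * k\<close>, and it reaches \<open>k\<close>
      exactly when \<open>r < b\<close>.\<close>
    then have "(b + (k - Suc r)) div k = (if r < b then 1 else 0)"
      using b by (auto intro!: div_nat_eqI)
    then have "(n + (k - Suc r)) div k = m r"
      using b by (simp add: assms(3) m_def add.assoc)
    then show "fact ((n + (k - Suc r)) div k) = (fact (m r) :: real)" by simp
  qed
  moreover have "(\<Prod>r<k. fact (m r) :: real) \<noteq> 0"
    by simp
  ultimately show ?thesis
    using count by (simp add: field_simps)
qed

end
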